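(* Consider the equation $$-iu_t=u_{xx}+u^2,\qquad x\in\mathbb{T}^1=\mathbb{R}/\mathbb{Z},$$ for complex valued $u$. There exist two distinct analytic, spectrally unstable equilibria $u_1^{i}$ and $u_1^{ii}$ of this equation. By the rescaling $$u_n(x)=n^{2}u_1(nx),\qquad n\in\mathbb{N}\ (n\ge 1),$$ these equilibria (and their complex conjugates) generate infinite families of spectrally unstable equilibria: for every $n\in\mathbb{N}$, $u_n^{i}(x)=n^2u_1^{i}(nx)$ and $u_n^{ii}(x)=n^2u_1^{ii}(nx)$, as well as their complex conjugates, are spectrally unstable equilibria.
   Context: An equilibrium is a time independent solution, i.e. $u:\mathbb{T}^1\to\mathbb{C}$ with $u_{xx}+u^2=0$. It is spectrally unstable if the linearized operator $b\mapsto i(b_{xx}+2ub)$ on (complex valued) functions on $\mathbb{T}^1$ has an eigenvalue with strictly positive real part. *)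

theory Defs
  imports "HOL-Analysis.Analysis" "HOL-Library.Periodic_Fun"
begin

text \<open>
  Functions on the circle \<open>\<real>/\<int>\<close> are represented by functions on \<open>\<real>\<close> satisfying
  \<^const>\<open>periodic_fun_simple'\<close>, i.e. \<open>f (x + 1) = f x\<close>.
\<close>

definition has_second_derivative :: "(real \<Rightarrow> complex) \<Rightarrow> (real \<Rightarrow> complex) \<Rightarrow> bool" where
  "has_second_derivative f f2 \<longleftrightarrow>
     (\<exists>f1. \<forall>x. (f has_vector_derivative f1 x) (at x) \<and> (f1 has_vector_derivative f2 x) (at x))"

text \<open>
  Classical solutions \<open>U t x\<close>, defined for all times, of \<open>- i U_t = U_xx + U^2\<close> on the circle.
\<close>

definition nls_solution :: "(real \<Rightarrow> real \<Rightarrow> complex) \<Rightarrow> bool" where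
  "nls_solution U \<longleftrightarrow>
     (\<forall>t. periodic_fun_simple' (U t)) \<and>
     (\<exists>Ut Uxx.
        (\<forall>t x. ((\<lambda>s. U s x) has_vector_derivative Ut t x) (at t)) \<and>
        (\<forall>t. has_second_derivative (U t) (Uxx t)) \<and>
        (\<forall>t x. - \<i> * Ut t x = Uxx t x + (U t x)\<^sup>2))"

definition equilibrium :: "(real \<Rightarrow> complex) \<Rightarrow> bool" where
  "equilibrium u \<longleftrightarrow> nls_solution (\<lambda>t. u)"

lemma equilibrium_iff:
  "equilibrium u \<longleftrightarrow>
     periodic_fun_simple' u \<and> (\<exists>uxx. has_second_derivative u uxx \<and> (\<forall>x. uxx x + (u x)\<^sup>2 = 0))"
proof
  assume "equilibrium u"
  then obtain ut uxx where p: "periodic_fun_simple' u"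
    and ut: "\<And>t x::real. ((\<lambda>s::real. u x) has_vector_derivative ut t x) (at t)"
    and uxx: "\<And>t::real. has_second_derivative u (uxx t)"
    and eq: "\<And>t x. - \<i> * ut t x = uxx t x + (u x)\<^sup>2"
    unfolding equilibrium_def nls_solution_def by blast
  have "ut t x = 0" for t x
    using vector_derivative_unique_at[OF ut[of x t] has_vector_derivative_const] .
  then have "uxx 0 x + (u x)\<^sup>2 = 0" for x
    using eq[of 0 x] by simp
  with p uxx[of 0] show "periodic_fun_simple' u \<and>
      (\<exists>uxx. has_second_derivative u uxx \<and> (\<forall>x. uxx x + (u x)\<^sup>2 = 0))"
    by blast
next
  assume "periodic_fun_simple' u \<and>
      (\<exists>uxx. has_second_derivative u uxx \<and> (\<forall>x. uxx x + (u x)\<^sup>2 = 0))"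
  then obtain uxx where "periodic_fun_simple' u" "has_second_derivative u uxx"
    "\<forall>x. uxx x + (u x)\<^sup>2 = 0"
    by blast
  then show "equilibrium u"
    unfolding equilibrium_def nls_solution_def
    by (intro conjI allI exI[of _ "\<lambda>t x. 0"] exI[of _ "\<lambda>t. uxx"]) auto
qed

text \<open>
  Eigenvalues, on the circle, of the linearization \<open>b \<mapsto> i (b_xx + 2 u b)\<close> at \<open>u\<close>;
  eigenfunctions are nonzero, periodic and twice differentiable.
\<close>

definition linearization_eigenvalue :: "(real \<Rightarrow> complex) \<Rightarrow> complex \<Rightarrow> bool" where
  "linearization_eigenvalue u \<mu> \<longleftrightarrow>
     (\<exists>b bxx. periodic_fun_simple' b \<and> b \<noteq> (\<lambda>x. 0) \<and> has_second_derivative b bxx \<and>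
        (\<forall>x. \<i> * (bxx x + 2 * u x * b x) = \<mu> * b x))"

definition spectrally_unstable :: "(real \<Rightarrow> complex) \<Rightarrow> bool" where
  "spectrally_unstable u \<longleftrightarrow> (\<exists>\<mu>. linearization_eigenvalue u \<mu> \<and> Re \<mu> > 0)"

definition real_analytic :: "(real \<Rightarrow> complex) \<Rightarrow> bool" where
  "real_analytic u \<longleftrightarrow>
     (\<forall>x0. \<exists>a. \<exists>r>0. \<forall>x. \<bar>x - x0\<bar> < r \<longrightarrow> (\<lambda>k. (x - x0) ^ k *\<^sub>R (a k :: complex)) sums u x)"

definition rescale :: "nat \<Rightarrow> (real \<Rightarrow> complex) \<Rightarrow> real \<Rightarrow> complex" where
  "rescale n u = (\<lambda>x. (of_nat n)\<^sup>2 * u (of_nat n * x))"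

end

theory Submission
  imports Defs "HOL-Complex_Analysis.Conformal_Mappings"
begin

text \<open>
  Equilibria are the periodic solutions of \<open>u'' = - u\<^sup>2\<close>; in terms of \<open>v = - u / 6\<close> this is
  \<open>v'' = 6 v\<^sup>2\<close>, the equation of the Weierstrass function with \<open>g\<^sub>2 = 0\<close>, whose period lattice is
  hexagonal. The equilibria sought are its restrictions to two lines that avoid the poles. On these
  lines the values lie on a circle: \<open>u = 6 (s\<^sup>2 - \<eta>)\<close>, where \<open>\<eta>\<close> is \<open>1\<close> or \<open>- 1\<close> and
  \<open>s = 3 powr (1/4) * cis \<theta>\<close> (up to the scaling that makes the period \<open>1\<close>). The equation becomes
  \<open>s'\<^sup>2 = 3 \<eta> s\<^sup>2 - s\<^sup>4 - 3\<close>, and this says that \<open>2 \<theta>\<close> is the angle of a pendulum whose oscillation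
  has amplitude \<open>pi / 6\<close> for \<open>\<eta> = 1\<close> and \<open>5 * pi / 6\<close> for \<open>\<eta> = - 1\<close>. So everything reduces to a
  real equation. The substitution \<open>sin \<theta> = sqrt m * sin \<psi>\<close> with \<open>m = (2 - \<eta> * sqrt 3) / 4\<close>
  replaces the oscillation by a rotation, \<open>\<psi>' = \<kappa> * sqrt (1 - m * (sin \<psi>)\<^sup>2)\<close>, which is solved by
  inverting an integral (\<open>rotation_exists\<close>, \<open>elliptic_orbit_pendulum_root\<close>). The solution is analytic
  because the same inversion works in the complex domain (\<open>autonomous_ode_analytic\<close>).

  The linearization at \<open>u = - 6 v\<close> is \<open>\<i>\<close> times the operator \<open>b'' - 12 v b\<close> of Lame, which has
  eigenfunctions of closed form. Here they are \<open>b = s (\<gamma> - s\<^sup>2)\<close>, where \<open>\<gamma>\<close> is either of the two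
  nonreal roots of \<open>5 \<gamma>\<^sup>2 - 12 \<eta> \<gamma> + 9\<close> (\<open>eigenvalue_orbit\<close>). The two eigenvalues have nonzero real
  parts of opposite signs. The positive one proves instability. As conjugation of \<open>u\<close> changes the
  sign of the real part of an eigenvalue, the negative one proves instability of the conjugate.

  Rescaling by \<open>n\<close> multiplies eigenvalues by \<open>n\<^sup>2\<close>. Finally, the two equilibria differ because \<open>u\<close> has
  positive real part everywhere for \<open>\<eta> = 1\<close>, but negative real part at the turning points of the
  pendulum for \<open>\<eta> = - 1\<close>.
\<close>

section \<open>Rescaling and conjugation\<close>

lemma has_second_derivative_rescale:
  assumes "has_second_derivative f f2"
  shows "has_second_derivative (\<lambda>x. c * f (r * x)) (\<lambda>x. c * (of_real r)\<^sup>2 * f2 (r * x))"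
proof -
  obtain f1 where f1: "\<And>x. (f has_vector_derivative f1 x) (at x)"
    "\<And>x. (f1 has_vector_derivative f2 x) (at x)"
    using assms unfolding has_second_derivative_def by blast
  have chain: "((\<lambda>x. g (r * x)) has_vector_derivative of_real r * g' (r * x)) (at x)"
    if "\<And>x. (g has_vector_derivative g' x) (at x)" for g g' :: "real \<Rightarrow> complex" and x
  proof -
    have "((\<lambda>x. r * x) has_vector_derivative r) (at x)"
      by (auto intro!: derivative_eq_intros)
    from vector_diff_chain_at[OF this that]
    show ?thesis by (simp add: o_def scaleR_conv_of_real)
  qed
  show ?thesis
    unfolding has_second_derivative_def
  proof (intro exI[of _ "\<lambda>x. c * of_real r * f1 (r * x)"] allI conjI)
    fix x
    show "((\<lambda>x. c * f (r * x)) has_vector_derivative c * of_real r * f1 (r * x)) (at x)"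
      using has_vector_derivative_mult_right[OF chain[OF f1(1)], of c] by (simp add: mult.assoc)
    show "((\<lambda>x. c * of_real r * f1 (r * x)) has_vector_derivative
        c * (of_real r)\<^sup>2 * f2 (r * x)) (at x)"
      using has_vector_derivative_mult_right[OF chain[OF f1(2)], of "c * of_real r"]
      by (simp add: mult.assoc power2_eq_square)
  qed
qed

lemma has_second_derivative_cnj:
  assumes "has_second_derivative f f2"
  shows "has_second_derivative (\<lambda>x. cnj (f x)) (\<lambda>x. cnj (f2 x))"
proof -
  obtain f1 where "\<And>x. (f has_vector_derivative f1 x) (at x)"
    "\<And>x. (f1 has_vector_derivative f2 x) (at x)"
    using assms unfolding has_second_derivative_def by blast
  then show ?thesis
    unfolding has_second_derivative_def
    by (intro exI[of _ "\<lambda>x. cnj (f1 x)"] allI conjI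
        bounded_linear.has_vector_derivative[OF bounded_linear_cnj])
qed

lemma periodic_rescale:
  assumes "periodic_fun_simple' f"
  shows "periodic_fun_simple' (\<lambda>x. c * f (real n * x))"
proof -
  interpret periodic_fun_simple' f by (rule assms)
  show ?thesis
    by unfold_locales (simp add: distrib_left plus_of_nat)
qed

lemma equilibrium_rescale:
  assumes "equilibrium u"
  shows "equilibrium (rescale n u)"
proof -
  obtain uxx where u: "periodic_fun_simple' u" "has_second_derivative u uxx"
    "\<And>x. uxx x + (u x)\<^sup>2 = 0"
    using assms unfolding equilibrium_iff by blast
  have "(of_nat n)\<^sup>2 * (of_real (real n))\<^sup>2 * uxx (real n * x) + (rescale n u x)\<^sup>2
      = (of_nat n) ^ 4 * (uxx (real n * x) + (u (real n * x))\<^sup>2)" for x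
    unfolding rescale_def of_real_of_nat_eq by algebra
  then have "(of_nat n)\<^sup>2 * (of_real (real n))\<^sup>2 * uxx (real n * x) + (rescale n u x)\<^sup>2 = 0" for x
    using u(3) by simp
  then show ?thesis
    unfolding equilibrium_iff
    using periodic_rescale[OF u(1), of "(of_nat n)\<^sup>2" n]
      has_second_derivative_rescale[OF u(2), of "(of_nat n)\<^sup>2" "real n"]
    by (auto simp: rescale_def)
qed

lemma equilibrium_cnj:
  assumes "equilibrium u"
  shows "equilibrium (\<lambda>x. cnj (u x))"
proof -
  obtain uxx where u: "periodic_fun_simple' u" "has_second_derivative u uxx"
    "\<And>x. uxx x + (u x)\<^sup>2 = 0"
    using assms unfolding equilibrium_iff by blast
  have "cnj (uxx x) + (cnj (u x))\<^sup>2 = cnj (uxx x + (u x)\<^sup>2)" for x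
    by simp
  then have "cnj (uxx x) + (cnj (u x))\<^sup>2 = 0" for x
    using u(3) by simp
  moreover have "periodic_fun_simple' (\<lambda>x. cnj (u x))"
    using u(1) unfolding periodic_fun_simple'_def by simp
  ultimately show ?thesis
    unfolding equilibrium_iff using has_second_derivative_cnj[OF u(2)] by blast
qed

lemma linearization_eigenvalue_rescale:
  assumes "linearization_eigenvalue u \<mu>" "n \<ge> 1"
  shows "linearization_eigenvalue (rescale n u) ((of_nat n)\<^sup>2 * \<mu>)"
proof -
  obtain b bxx where b: "periodic_fun_simple' b" "b \<noteq> (\<lambda>x. 0)" "has_second_derivative b bxx"
    "\<And>x. \<i> * (bxx x + 2 * u x * b x) = \<mu> * b x"
    using assms(1) unfolding linearization_eigenvalue_def by auto
  obtain x0 where "b x0 \<noteq> 0"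
    using b(2) by blast
  then have "(\<lambda>x. b (real n * x)) (x0 / real n) \<noteq> 0"
    using assms(2) by simp
  then have "(\<lambda>x. b (real n * x)) \<noteq> (\<lambda>x. 0)"
    by metis
  moreover have "\<i> * ((of_nat n)\<^sup>2 * bxx (real n * x) + 2 * rescale n u x * b (real n * x))
      = (of_nat n)\<^sup>2 * \<mu> * b (real n * x)" for x
    using b(4)[of "real n * x"] unfolding rescale_def by algebra
  ultimately show ?thesis
    unfolding linearization_eigenvalue_def
    using periodic_rescale[OF b(1), of 1 n] has_second_derivative_rescale[OF b(3), of 1 "real n"]
    by (intro exI[of _ "\<lambda>x. b (real n * x)"] exI[of _ "\<lambda>x. (of_nat n)\<^sup>2 * bxx (real n * x)"]) auto
qed

text \<open>
  Conjugation turns the factor \<open>\<i>\<close> of the linearized operator into \<open>- \<i>\<close>, so it reflects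
  the spectrum in the imaginary axis instead of the real one.
\<close>

lemma linearization_eigenvalue_cnj:
  assumes "linearization_eigenvalue u \<mu>"
  shows "linearization_eigenvalue (\<lambda>x. cnj (u x)) (- cnj \<mu>)"
proof -
  obtain b bxx where b: "periodic_fun_simple' b" "b \<noteq> (\<lambda>x. 0)" "has_second_derivative b bxx"
    "\<And>x. \<i> * (bxx x + 2 * u x * b x) = \<mu> * b x"
    using assms(1) unfolding linearization_eigenvalue_def by auto
  have "\<i> * (cnj (bxx x) + 2 * cnj (u x) * cnj (b x)) = - cnj \<mu> * cnj (b x)" for x
  proof -
    have "cnj (\<i> * (bxx x + 2 * u x * b x)) = cnj (\<mu> * b x)"
      using b(4) by (rule arg_cong)
    then have "- \<i> * (cnj (bxx x) + 2 * cnj (u x) * cnj (b x)) = cnj \<mu> * cnj (b x)"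
      by (simp only: complex_cnj_mult complex_cnj_add complex_cnj_i complex_cnj_numeral)
    then show ?thesis by algebra
  qed
  moreover have "periodic_fun_simple' (\<lambda>x. cnj (b x))"
    using b(1) unfolding periodic_fun_simple'_def by simp
  moreover have "(\<lambda>x. cnj (b x)) \<noteq> (\<lambda>x. 0)"
    using b(2) by (metis complex_cnj_zero_iff)
  ultimately show ?thesis
    unfolding linearization_eigenvalue_def using has_second_derivative_cnj[OF b(3)] by blast
qed

lemma spectrally_unstable_rescale:
  assumes "linearization_eigenvalue u \<mu>" "Re \<mu> > 0" "n \<ge> 1"
  shows "spectrally_unstable (rescale n u)"
proof -
  have "Re ((of_nat n)\<^sup>2 * \<mu>) = (real n)\<^sup>2 * Re \<mu>"
    by (simp flip: of_nat_power)
  then show ?thesis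
    using linearization_eigenvalue_rescale[OF assms(1,3)] assms(2,3)
    unfolding spectrally_unstable_def by (metis zero_less_mult_iff zero_less_power of_nat_0_less_iff
        less_le_trans zero_less_one)
qed

lemma spectrally_unstable_cnj_rescale:
  assumes "linearization_eigenvalue u \<mu>" "Re \<mu> < 0" "n \<ge> 1"
  shows "spectrally_unstable (\<lambda>x. cnj (rescale n u x))"
proof -
  have "Re (- cnj ((of_nat n)\<^sup>2 * \<mu>)) = (real n)\<^sup>2 * (- Re \<mu>)"
    by (simp flip: of_nat_power)
  then have "Re (- cnj ((of_nat n)\<^sup>2 * \<mu>)) > 0"
    using assms(2,3) by (metis zero_less_mult_iff zero_less_power of_nat_0_less_iff
        less_le_trans zero_less_one neg_0_less_iff_less)
  then show ?thesis
    using linearization_eigenvalue_cnj[OF linearization_eigenvalue_rescale[OF assms(1,3)]]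
    unfolding spectrally_unstable_def by blast
qed

lemma infinite_rescale:
  assumes "u 0 \<noteq> 0"
  shows "infinite {rescale n u | n. n \<ge> 1}"
    and "infinite {(\<lambda>x. cnj (rescale n u x)) | n. n \<ge> 1}"
proof -
  have inj: "inj (\<lambda>n. rescale n u)"
  proof (rule injI)
    fix m n assume "rescale m u = rescale n u"
    then have "rescale m u 0 = rescale n u 0" by simp
    then have "(of_nat m :: complex)\<^sup>2 = (of_nat n)\<^sup>2"
      using assms by (simp add: rescale_def)
    then have "(of_nat (m\<^sup>2) :: complex) = of_nat (n\<^sup>2)" by simp
    then have "m\<^sup>2 = n\<^sup>2" by (simp only: of_nat_eq_iff)
    then show "m = n" by simp
  qed
  have inj': "inj (\<lambda>n x. cnj (rescale n u x))"
  proof (rule injI)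
    fix m n assume "(\<lambda>x. cnj (rescale m u x)) = (\<lambda>x. cnj (rescale n u x))"
    then have "rescale m u = rescale n u"
      by (metis (no_types, lifting) complex_cnj_cnj ext)
    then show "m = n" by (rule injD[OF inj])
  qed
  have "infinite {n::nat. n \<ge> 1}"
    by (metis atLeast_def infinite_Ici)
  then show "infinite {rescale n u | n. n \<ge> 1}" "infinite {(\<lambda>x. cnj (rescale n u x)) | n. n \<ge> 1}"
    unfolding setcompr_eq_image
    using inj inj' by (metis finite_imageD inj_on_subset subset_UNIV)+
qed

section \<open>Real analyticity\<close>

lemma real_analyticI:
  assumes "\<And>x0. \<exists>H. H analytic_on {of_real x0} \<and> (\<forall>\<^sub>F x in nhds x0. u x = H (of_real x))"
  shows "real_analytic u"
  unfolding real_analytic_def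
proof
  fix x0
  obtain H where H: "H analytic_on {of_real x0}" "\<forall>\<^sub>F x in nhds x0. u x = H (of_real x)"
    using assms by blast
  obtain e where e: "e > 0" "H holomorphic_on ball (of_real x0) e"
    using H(1) unfolding analytic_at_ball by blast
  obtain d where d: "d > 0" "\<And>x. dist x x0 < d \<Longrightarrow> u x = H (of_real x)"
    using H(2) unfolding eventually_nhds_metric by blast
  define a where "a k = (deriv ^^ k) H (of_real x0) / fact k" for k
  show "\<exists>a. \<exists>r>0. \<forall>x. \<bar>x - x0\<bar> < r \<longrightarrow> (\<lambda>k. (x - x0) ^ k *\<^sub>R (a k :: complex)) sums u x"
  proof (intro exI[of _ a] exI[of _ "min d e"] conjI allI impI)
    show "min d e > 0" using d e by simp
    fix x assume x: "\<bar>x - x0\<bar> < min d e"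
    have "dist (of_real x0) (of_real x :: complex) = \<bar>x - x0\<bar>"
      unfolding dist_of_real by (simp add: dist_real_def abs_minus_commute)
    then have "of_real x \<in> ball (of_real x0 :: complex) e"
      using x by (simp only: mem_ball min_less_iff_conj)
    from holomorphic_power_series[OF e(2) this]
    have "(\<lambda>k. (x - x0) ^ k *\<^sub>R a k) sums H (of_real x)"
      by (simp add: a_def scaleR_conv_of_real mult.commute)
    then show "(\<lambda>k. (x - x0) ^ k *\<^sub>R a k) sums u x"
      using d(2)[of x] x by (simp add: dist_real_def)
  qed
qed

text \<open>
  Separation of variables: if \<open>G\<close> is a holomorphic primitive of \<open>1/g\<close>, then \<open>G (y x) - x\<close>
  is constant, and the local inverse of \<open>G\<close> extends \<open>y\<close> to the complex domain.
\<close>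

lemma autonomous_ode_analytic:
  fixes y :: "real \<Rightarrow> complex"
  assumes g: "g analytic_on {y x0}" "g (y x0) \<noteq> 0"
    and ode: "\<And>x. (y has_vector_derivative g (y x)) (at x)"
  shows "\<exists>H. H analytic_on {of_real x0} \<and> (\<forall>\<^sub>F x in nhds x0. y x = H (of_real x))"
proof -
  obtain e1 where e1: "e1 > 0" "g holomorphic_on ball (y x0) e1"
    using g(1) unfolding analytic_at_ball by blast
  have "continuous (at (y x0)) g"
    using g(1) analytic_at_imp_isCont by blast
  then obtain e2 where e2: "e2 > 0" "\<And>z. dist (y x0) z < e2 \<Longrightarrow> g z \<noteq> 0"
    using continuous_at_avoid g(2) by blast
  define B where "B = ball (y x0) (min e1 e2)"
  have B: "open B" "convex B" "y x0 \<in> B"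
    using e1 e2 by (auto simp: B_def)
  have gB: "g holomorphic_on B" "\<And>z. z \<in> B \<Longrightarrow> g z \<noteq> 0"
    using e1 e2 by (auto simp: B_def elim: holomorphic_on_subset)
  have inv: "(\<lambda>z. inverse (g z)) holomorphic_on B"
    using gB by (intro holomorphic_intros) auto
  obtain G0 where G0: "\<And>z. z \<in> B \<Longrightarrow> (G0 has_field_derivative inverse (g z)) (at z within B)"
  proof (rule holomorphic_convex_primitive'[OF B(2,1) inv])
    fix G assume "\<And>z. z \<in> B \<Longrightarrow> (G has_field_derivative inverse (g z)) (at z within B)"
    then show thesis by (rule that)
  qed
  define G where "G z = G0 z - G0 (y x0) + of_real x0" for z
  have G: "(G has_field_derivative inverse (g z)) (at z)" if "z \<in> B" for z
  proof -
    have "(G0 has_field_derivative inverse (g z)) (at z)"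
      using G0[OF that] unfolding at_within_open[OF that B(1)] .
    then show ?thesis
      unfolding G_def by (auto intro!: derivative_eq_intros)
  qed
  have holG: "G holomorphic_on B"
    using G B(1) by (auto simp: holomorphic_on_open)
  have "deriv G (y x0) \<noteq> 0"
    using DERIV_imp_deriv[OF G[OF B(3)]] gB(2)[OF B(3)] by simp
  then obtain r where r: "r > 0" "ball (y x0) r \<subseteq> B" "open (G ` ball (y x0) r)"
    "inj_on G (ball (y x0) r)"
    using has_complex_derivative_locally_invertible[OF holG B(3,1)] by metis
  obtain H where H: "H holomorphic_on (G ` ball (y x0) r)"
    "\<And>z. z \<in> ball (y x0) r \<Longrightarrow> H (G z) = z"
    using holomorphic_has_inverse[OF holomorphic_on_subset[OF holG r(2)] open_ball r(4)] by metis
  have "isCont y x0"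
    using ode has_vector_derivative_continuous by blast
  then obtain d where d: "d > 0" "\<And>x. dist x x0 < d \<Longrightarrow> y x \<in> ball (y x0) r"
    using r(1) unfolding continuous_at_eps_delta by (metis dist_commute mem_ball)
  have const: "((\<lambda>x. G (y x) - of_real x) has_derivative (\<lambda>h. 0)) (at x within ball x0 d)"
    if "x \<in> ball x0 d" for x
  proof -
    have "dist x x0 < d" using that by (simp add: dist_commute)
    then have yx: "y x \<in> B" using d(2) r(2) by blast
    have "((\<lambda>x. G (y x)) has_vector_derivative 1) (at x)"
      using field_vector_diff_chain_at[OF ode[of x] G[OF yx]] gB(2)[OF yx] by (simp add: o_def)
    moreover have "(of_real has_vector_derivative (1::complex)) (at x)"
      using has_vector_derivative_of_real[OF DERIV_ident] by simp
    ultimately have "((\<lambda>x. G (y x) - of_real x) has_vector_derivative 1 - 1) (at x)"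
      by (rule has_vector_derivative_diff)
    then show ?thesis
      by (simp add: has_vector_derivative_def has_derivative_at_withinI)
  qed
  obtain c where c: "\<And>x. x \<in> ball x0 d \<Longrightarrow> G (y x) - of_real x = c"
    using has_derivative_zero_constant[OF convex_ball const] by blast
  have "c = 0" using c[of x0] d(1) by (simp add: G_def)
  then have "y x = H (of_real x)" if "dist x x0 < d" for x
    using c[of x] H(2)[OF d(2)[OF that]] that by (simp add: dist_commute)
  then have "\<forall>\<^sub>F x in nhds x0. y x = H (of_real x)"
    using d(1) unfolding eventually_nhds_metric by blast
  moreover have "of_real x0 \<in> G ` ball (y x0) r"
    using r(1) by (intro image_eqI[of _ _ "y x0"]) (auto simp: G_def)
  then have "H analytic_on {of_real x0}"
    using H(1) r(3) by (meson analytic_at)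
  ultimately show ?thesis by blast
qed

section \<open>Rotation on a circle\<close>

text \<open>
  The time that \<open>y' = g y\<close> takes to travel along the line is a primitive of \<open>1/g\<close>. It grows by
  the same amount along every period of \<open>g\<close>, so after normalization of that amount to \<open>1\<close> its
  inverse function is a solution.
\<close>

lemma rotation_exists:
  fixes g :: "real \<Rightarrow> real"
  assumes cont: "continuous_on UNIV g" and pos: "\<And>\<alpha>. g \<alpha> > 0"
    and per: "\<And>\<alpha>. g (\<alpha> + \<tau>) = g \<alpha>" and \<tau>: "\<tau> > 0"
  obtains \<kappa> \<psi> where "\<kappa> > 0" "\<And>x. (\<psi> has_real_derivative \<kappa> * g (\<psi> x)) (at x)"
    "\<And>x. \<psi> (x + 1) = \<psi> x + \<tau>" "\<psi> 0 = (0 :: real)" "surj \<psi>"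
proof -
  have "isCont (\<lambda>\<alpha>. inverse (g \<alpha>)) \<alpha>" for \<alpha>
    using cont pos[of \<alpha>] by (intro continuous_intros) (auto simp: continuous_on_eq_continuous_at)
  then have "\<exists>F. \<forall>\<alpha>. -\<infinity> < ereal \<alpha> \<longrightarrow> ereal \<alpha> < \<infinity> \<longrightarrow> (F has_vector_derivative inverse (g \<alpha>)) (at \<alpha>)"
    by (intro einterval_antiderivative) auto
  then obtain F where F: "\<And>\<alpha>. (F has_real_derivative inverse (g \<alpha>)) (at \<alpha>)"
    by (auto simp: has_real_derivative_iff_has_vector_derivative)
  define \<kappa> where "\<kappa> = F \<tau> - F 0"
  have F_mono: "F a < F b" if "a < b" for a b
    using DERIV_pos_imp_increasing[OF that, of F] F pos by (metis positive_imp_inverse_positive)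
  have \<kappa>: "\<kappa> > 0"
    using F_mono[OF \<tau>] by (simp add: \<kappa>_def)
  define X where "X \<alpha> = (F \<alpha> - F 0) / \<kappa>" for \<alpha>
  have X_deriv: "(X has_real_derivative inverse (\<kappa> * g \<alpha>)) (at \<alpha>)" for \<alpha>
    unfolding X_def using F[of \<alpha>] \<kappa>
    by (auto intro!: derivative_eq_intros simp: field_simps)
  have X_mono: "X a < X b" if "a < b" for a b
    using F_mono[OF that] \<kappa> by (simp add: X_def divide_strict_right_mono)
  have X_shift: "X (\<alpha> + \<tau>) = X \<alpha> + 1" for \<alpha>
  proof -
    have "((\<lambda>\<alpha>. X (\<alpha> + \<tau>) - X \<alpha>) has_real_derivative 0) (at \<alpha>)" for \<alpha>
      using DERIV_diff[OF DERIV_shift[THEN iffD1, OF X_deriv[of "\<alpha> + \<tau>"]] X_deriv[of \<alpha>]]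
      by (simp add: per)
    then have "X (\<alpha> + \<tau>) - X \<alpha> = X (0 + \<tau>) - X 0"
      using DERIV_isconst_all by blast
    then show ?thesis using \<kappa> by (simp add: X_def \<kappa>_def divide_simps split: if_splits)
  qed
  have X_int: "X (real n * \<tau>) = real n" "X (- (real n * \<tau>)) = - real n" for n
  proof (induction n)
    case (Suc n)
    show "X (real (Suc n) * \<tau>) = real (Suc n)"
      using Suc(1) X_shift[of "real n * \<tau>"] by (simp add: algebra_simps)
    show "X (- (real (Suc n) * \<tau>)) = - real (Suc n)"
      using Suc(2) X_shift[of "- (real (Suc n) * \<tau>)"] by (simp add: algebra_simps)
  qed (auto simp: X_def)
  have X_cont: "isCont X \<alpha>" for \<alpha>
    using X_deriv DERIV_isCont by blast
  have "\<exists>\<alpha>. X \<alpha> = x" for x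
  proof -
    obtain n where n: "\<bar>x\<bar> < real n" using reals_Archimedean2 by blast
    have "\<exists>\<alpha>\<ge>- (real n * \<tau>). \<alpha> \<le> real n * \<tau> \<and> X \<alpha> = x"
      using n \<tau> X_cont by (intro IVT) (auto simp: X_int mult_nonneg_nonneg)
    then show ?thesis by blast
  qed
  then have "surj X" by (metis surjI)
  have "inj X"
    using X_mono by (intro injI) (metis less_irrefl linorder_neqE)
  define \<psi> where "\<psi> = inv X"
  have \<psi>X: "\<psi> (X \<alpha>) = \<alpha>" for \<alpha> using \<open>inj X\<close> by (simp add: \<psi>_def)
  have X\<psi>: "X (\<psi> x) = x" for x using \<open>surj X\<close> by (simp add: \<psi>_def surj_f_inv_f)
  have "isCont \<psi> x" for x
    using isCont_inverse_function[where d = 1 and x = "\<psi> x" and f = X and g = \<psi>]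
      X_cont \<psi>X X\<psi> by simp
  moreover have "\<kappa> * g (\<psi> x) \<noteq> 0" for x
    using \<kappa> pos[of "\<psi> x"] by simp
  ultimately have "(\<psi> has_real_derivative inverse (inverse (\<kappa> * g (\<psi> x)))) (at x)" for x
    by (intro DERIV_inverse_function[where f = X and a = "x - 1" and b = "x + 1"] X_deriv X\<psi>) auto
  then have "(\<psi> has_real_derivative \<kappa> * g (\<psi> x)) (at x)" for x by simp
  moreover have "\<psi> (x + 1) = \<psi> x + \<tau>" for x
    using X_shift[of "\<psi> x"] \<psi>X X\<psi> by metis
  moreover have "\<psi> 0 = 0"
    using \<psi>X[of 0] by (simp add: X_def)
  moreover have "surj \<psi>" using \<psi>X by (metis surjI)
  ultimately show ?thesis using that[OF \<kappa>] by blast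
qed

section \<open>The square root of the equilibrium\<close>

text \<open>
  The last condition is a first integral of the second-order equation that precedes it; it fixes
  the constant of integration, which the equation of \<open>s\<^sup>2\<close> needs.
\<close>

definition elliptic_orbit :: "real \<Rightarrow> real \<Rightarrow> (real \<Rightarrow> complex) \<Rightarrow> bool" where
  "elliptic_orbit \<eta> P s \<longleftrightarrow> (\<forall>x. s (x + 1) = s x) \<and>
     (\<exists>s1. \<forall>x. (s has_vector_derivative s1 x) (at x) \<and>
        (s1 has_vector_derivative (of_real P)\<^sup>2 * (3 * of_real \<eta> * s x - 2 * s x ^ 3)) (at x) \<and>
        (s1 x)\<^sup>2 = (of_real P)\<^sup>2 * (3 * of_real \<eta> * (s x)\<^sup>2 - s x ^ 4 - 3))"

definition orbit_equilibrium :: "real \<Rightarrow> real \<Rightarrow> (real \<Rightarrow> complex) \<Rightarrow> real \<Rightarrow> complex" where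
  "orbit_equilibrium \<eta> P s x = 6 * (of_real P)\<^sup>2 * ((s x)\<^sup>2 - of_real \<eta>)"

text \<open>
  By the two equations for \<open>s\<close>, \<open>(s\<^sup>2)'' = 2 s'\<^sup>2 + 2 s s'' = - 6 P\<^sup>2 (s\<^sup>2 - \<eta>)\<^sup>2\<close>, where the
  square is complete because \<open>\<eta>\<^sup>2 = 1\<close>.
\<close>

lemma equilibrium_orbit:
  assumes orbit: "elliptic_orbit \<eta> P s" and \<eta>: "\<eta>\<^sup>2 = 1"
  shows "equilibrium (orbit_equilibrium \<eta> P s)"
proof -
  define p e where "p = complex_of_real P" and "e = complex_of_real \<eta>"
  have e: "e\<^sup>2 = 1" using \<eta> by (simp add: e_def flip: of_real_power)
  obtain s1 where s: "\<And>x. s (x + 1) = s x"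
    "\<And>x. (s has_vector_derivative s1 x) (at x)"
    "\<And>x. (s1 has_vector_derivative p\<^sup>2 * (3 * e * s x - 2 * s x ^ 3)) (at x)"
    "\<And>x. (s1 x)\<^sup>2 = p\<^sup>2 * (3 * e * (s x)\<^sup>2 - s x ^ 4 - 3)"
    using orbit unfolding elliptic_orbit_def p_def e_def by blast
  define u1 where "u1 x = 12 * p\<^sup>2 * (s x * s1 x)" for x
  define u2 where "u2 x = 12 * p\<^sup>2 * ((s1 x)\<^sup>2 + s x * (p\<^sup>2 * (3 * e * s x - 2 * s x ^ 3)))" for x
  have "has_second_derivative (orbit_equilibrium \<eta> P s) u2"
    unfolding has_second_derivative_def
  proof (intro exI[of _ u1] allI conjI)
    fix x
    have "((\<lambda>x. 6 * p\<^sup>2 * (s x * s x - e)) has_vector_derivative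
        6 * p\<^sup>2 * (s x * s1 x + s1 x * s x - 0)) (at x)"
      by (intro has_vector_derivative_mult_right has_vector_derivative_diff
          has_vector_derivative_mult has_vector_derivative_const s)
    then show "(orbit_equilibrium \<eta> P s has_vector_derivative u1 x) (at x)"
      by (simp add: orbit_equilibrium_def[abs_def] u1_def p_def e_def power2_eq_square algebra_simps)
    have "(u1 has_vector_derivative
        12 * p\<^sup>2 * (s x * (p\<^sup>2 * (3 * e * s x - 2 * s x ^ 3)) + s1 x * s1 x)) (at x)"
      unfolding u1_def[abs_def]
      by (intro has_vector_derivative_mult_right has_vector_derivative_mult s)
    then show "(u1 has_vector_derivative u2 x) (at x)"
      by (simp add: u2_def power2_eq_square add.commute)
  qed
  moreover have "u2 x + (orbit_equilibrium \<eta> P s x)\<^sup>2 = 0" for x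
    using e unfolding u2_def s(4) orbit_equilibrium_def p_def[symmetric] e_def[symmetric]
    by algebra
  moreover have "periodic_fun_simple' (orbit_equilibrium \<eta> P s)"
    by unfold_locales (simp add: orbit_equilibrium_def s(1))
  ultimately show ?thesis
    unfolding equilibrium_iff by blast
qed

text \<open>
  For \<open>b = s (\<gamma> - s\<^sup>2)\<close> the terms of degree 5 in \<open>s\<close> cancel in \<open>b'' + 2 u b\<close>, so that it is \<open>P\<^sup>2\<close> times
  a combination of \<open>s\<close> and \<open>s\<^sup>3\<close>. Comparison of the coefficients of \<open>s\<^sup>3\<close> gives the
  eigenvalue \<open>15 \<eta> - 10 \<gamma>\<close>; that of \<open>s\<close> then gives the quadratic equation for \<open>\<gamma>\<close>.
\<close>

lemma eigenvalue_orbit: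
  assumes orbit: "elliptic_orbit \<eta> P s" and \<eta>: "\<eta>\<^sup>2 = 1"
    and \<gamma>: "5 * \<gamma>\<^sup>2 - 12 * of_real \<eta> * \<gamma> + 9 = 0"
    and nz: "s x0 \<noteq> 0" "(s x0)\<^sup>2 \<noteq> \<gamma>"
  shows "linearization_eigenvalue (orbit_equilibrium \<eta> P s)
    (\<i> * ((of_real P)\<^sup>2 * (15 * of_real \<eta> - 10 * \<gamma>)))"
proof -
  define p e where "p = complex_of_real P" and "e = complex_of_real \<eta>"
  have e: "e\<^sup>2 = 1" using \<eta> by (simp add: e_def flip: of_real_power)
  obtain s1 where s: "\<And>x. s (x + 1) = s x"
    "\<And>x. (s has_vector_derivative s1 x) (at x)"
    "\<And>x. (s1 has_vector_derivative p\<^sup>2 * (3 * e * s x - 2 * s x ^ 3)) (at x)"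
    "\<And>x. (s1 x)\<^sup>2 = p\<^sup>2 * (3 * e * (s x)\<^sup>2 - s x ^ 4 - 3)"
    using orbit unfolding elliptic_orbit_def p_def e_def by blast
  define b where "b x = s x * (\<gamma> - s x * s x)" for x
  define b1 where "b1 x = s1 x * (\<gamma> - 3 * (s x * s x))" for x
  define b2 where "b2 x = p\<^sup>2 * (3 * e * s x - 2 * s x ^ 3) * (\<gamma> - 3 * (s x)\<^sup>2)
     - 6 * s x * (s1 x)\<^sup>2" for x
  have "has_second_derivative b b2"
    unfolding has_second_derivative_def
  proof (intro exI[of _ b1] allI conjI)
    fix x
    have "(b has_vector_derivative s x * (0 - (s x * s1 x + s1 x * s x)) + s1 x * (\<gamma> - s x * s x)) (at x)"
      unfolding b_def[abs_def]
      by (intro has_vector_derivative_diff has_vector_derivative_mult has_vector_derivative_const s)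
    then show "(b has_vector_derivative b1 x) (at x)"
      by (simp add: b1_def algebra_simps)
    have "(b1 has_vector_derivative s1 x * (0 - 3 * (s x * s1 x + s1 x * s x))
        + p\<^sup>2 * (3 * e * s x - 2 * s x ^ 3) * (\<gamma> - 3 * (s x * s x))) (at x)"
      unfolding b1_def[abs_def]
      by (intro has_vector_derivative_diff has_vector_derivative_mult has_vector_derivative_mult_right
          has_vector_derivative_const s)
    then show "(b1 has_vector_derivative b2 x) (at x)"
      by (simp add: b2_def power2_eq_square algebra_simps)
  qed
  moreover have "\<i> * (b2 x + 2 * orbit_equilibrium \<eta> P s x * b x)
      = \<i> * (p\<^sup>2 * (15 * e - 10 * \<gamma>)) * b x" for x
  proof -
    have "b2 x + 2 * orbit_equilibrium \<eta> P s x * b x = p\<^sup>2 * (15 * e - 10 * \<gamma>) * b x"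
      using e \<gamma> unfolding b2_def s(4) b_def orbit_equilibrium_def p_def[symmetric] e_def[symmetric]
      by algebra
    then show ?thesis by simp
  qed
  moreover have "periodic_fun_simple' b"
    by unfold_locales (simp add: b_def s(1))
  moreover have "b x0 \<noteq> 0"
    using nz by (simp add: b_def power2_eq_square)
  then have "b \<noteq> (\<lambda>x. 0)" by auto
  ultimately show ?thesis
    unfolding linearization_eigenvalue_def p_def e_def by blast
qed

text \<open>
  For \<open>0 \<le> m \<le> 1\<close> this is \<open>3 powr (1/4) * cis \<theta>\<close> with \<open>\<theta> = arcsin (sqrt m * sin \<psi>)\<close>. If \<open>\<psi>\<close> is the
  amplitude of an elliptic function of parameter \<open>m\<close>, then \<open>2 \<theta>\<close> is the angle of a
  pendulum whose turning points are \<open>\<plusminus> 2 arcsin (sqrt m)\<close>.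
\<close>

definition pendulum_root :: "real \<Rightarrow> (real \<Rightarrow> real) \<Rightarrow> real \<Rightarrow> complex" where
  "pendulum_root m \<psi> x =
     of_real (sqrt (sqrt 3)) * Complex (sqrt (1 - m * (sin (\<psi> x))\<^sup>2)) (sqrt m * sin (\<psi> x))"

lemma parameter_sin_le:
  fixes m \<alpha> :: real
  assumes "0 \<le> m"
  shows "m * (sin \<alpha>)\<^sup>2 \<le> m"
  using assms sin_squared_eq[of \<alpha>] by (simp add: mult_left_le)

lemma delta_pos:
  fixes m \<alpha> :: real
  assumes "0 \<le> m" "m < 1"
  shows "1 - m * (sin \<alpha>)\<^sup>2 > 0"
  using le_less_trans[OF parameter_sin_le assms(2)] assms(1) by simp

lemma pendulum_root_square:
  "(pendulum_root m \<psi> x)\<^sup>2 = of_real (sqrt 3) *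
     (of_real (sqrt (1 - m * (sin (\<psi> x))\<^sup>2)) + \<i> * of_real (sqrt m * sin (\<psi> x)))\<^sup>2"
proof -
  have "(complex_of_real (sqrt (sqrt 3)))\<^sup>2 = of_real (sqrt 3)"
    by (simp only: real_sqrt_pow2 real_sqrt_ge_zero zero_le_numeral flip: of_real_power)
  then show ?thesis
    by (simp only: pendulum_root_def Complex_eq power_mult_distrib)
qed

lemma Re_pendulum_root_square:
  assumes "0 \<le> m" "m < 1"
  shows "Re ((pendulum_root m \<psi> x)\<^sup>2) = sqrt 3 * (1 - 2 * m * (sin (\<psi> x))\<^sup>2)"
proof -
  define D S where "D = sqrt (1 - m * (sin (\<psi> x))\<^sup>2)" and "S = sqrt m * sin (\<psi> x)"
  have "Re ((pendulum_root m \<psi> x)\<^sup>2) = sqrt 3 * (D\<^sup>2 - S\<^sup>2)"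
    unfolding pendulum_root_square D_def[symmetric] S_def[symmetric]
    by (simp add: power2_eq_square)
  also have "D\<^sup>2 - S\<^sup>2 = 1 - 2 * m * (sin (\<psi> x))\<^sup>2"
    using assms delta_pos[OF assms, of "\<psi> x"] by (simp add: D_def S_def power_mult_distrib)
  finally show ?thesis .
qed

text \<open>
  Differentiation of \<open>sqrt m * sin \<psi>\<close>, \<open>sqrt m * cos \<psi>\<close> and \<open>sqrt (1 - m * (sin \<psi>)\<^sup>2)\<close> gives the
  rules for the Jacobi functions, and \<open>s' = \<i> \<kappa> (sqrt m * cos \<psi>) s\<close>. The value of \<open>m\<close> is the one
  that turns the coefficient of \<open>s\<^sup>2\<close> in \<open>s'\<^sup>2\<close> into \<open>3 \<eta>\<close>.
\<close>

lemma elliptic_orbit_pendulum_root: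
  assumes m: "0 < m" "m < 1" and m4: "sqrt 3 * (1 - 2 * m) = 3 * \<eta> / 2"
    and \<psi>: "\<And>x. (\<psi> has_real_derivative \<kappa> * sqrt (1 - m * (sin (\<psi> x))\<^sup>2)) (at x)"
      "\<And>x. \<psi> (x + 1) = \<psi> x + 2 * pi"
  shows "elliptic_orbit \<eta> (\<kappa> / (2 * sqrt (sqrt 3))) (pendulum_root m \<psi>)"
proof -
  define P where "P = \<kappa> / (2 * sqrt (sqrt 3))"
  have P2: "\<kappa>\<^sup>2 = 4 * sqrt 3 * P\<^sup>2"
    by (simp add: P_def power_divide power_mult_distrib)
  define s where "s = pendulum_root m \<psi>"
  define S C D where "S x = sqrt m * sin (\<psi> x)" and "C x = sqrt m * cos (\<psi> x)"
    and "D x = sqrt (1 - m * (sin (\<psi> x))\<^sup>2)" for x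
  have D: "(D x)\<^sup>2 = 1 - (S x)\<^sup>2" "D x > 0" for x
    using m delta_pos[of m "\<psi> x"] by (simp_all add: D_def S_def power_mult_distrib)
  have C: "(C x)\<^sup>2 = m - (S x)\<^sup>2" for x
    using m by (simp add: C_def S_def power_mult_distrib cos_squared_eq algebra_simps)
  have \<psi>': "(\<psi> has_real_derivative \<kappa> * D x) (at x)" for x
    using \<psi>(1) by (simp add: D_def)
  have S': "(S has_real_derivative \<kappa> * C x * D x) (at x)" for x
    unfolding S_def C_def by (auto intro!: derivative_eq_intros \<psi>')
  have C': "(C has_real_derivative - \<kappa> * S x * D x) (at x)" for x
    unfolding S_def C_def by (auto intro!: derivative_eq_intros \<psi>')
  have D': "(D has_real_derivative - \<kappa> * S x * C x) (at x)" for x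
  proof -
    have sqrt_D: "sqrt (1 - (S x)\<^sup>2) = D x" for x
      using D[of x] by (metis real_sqrt_unique less_imp_le)
    have "1 - (S x)\<^sup>2 > 0"
      using D[of x] by (metis zero_less_power)
    then have "((\<lambda>x. sqrt (1 - (S x)\<^sup>2)) has_real_derivative
        (- (2 * S x * (\<kappa> * C x * D x))) * (inverse (sqrt (1 - (S x)\<^sup>2)) / 2)) (at x)"
      by (auto intro!: derivative_eq_intros S' simp: algebra_simps)
    moreover have "(- (2 * S x * (\<kappa> * C x * D x))) * (inverse (D x) / 2) = - \<kappa> * S x * C x"
      using D(2)[of x] by (simp add: field_simps)
    ultimately show ?thesis unfolding sqrt_D by (simp only:)
  qed
  have s_eq: "s x = of_real (sqrt (sqrt 3)) * (of_real (D x) + \<i> * of_real (S x))" for x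
    by (simp add: s_def pendulum_root_def D_def S_def Complex_eq)
  have s_sq: "(s x)\<^sup>2 = of_real (sqrt 3) * (of_real (D x) + \<i> * of_real (S x))\<^sup>2" for x
    unfolding s_def D_def S_def by (rule pendulum_root_square)
  define s1 where "s1 x = \<i> * of_real (\<kappa> * C x) * s x" for x
  have deriv_s: "(s has_vector_derivative s1 x) (at x)" for x
  proof -
    have "((\<lambda>x. of_real (sqrt (sqrt 3)) * (of_real (D x) + \<i> * of_real (S x))) has_vector_derivative
        of_real (sqrt (sqrt 3)) * (of_real (- \<kappa> * S x * C x) + \<i> * of_real (\<kappa> * C x * D x))) (at x)"
      by (intro has_vector_derivative_mult_right has_vector_derivative_add
          has_vector_derivative_of_real S' D')
    then show ?thesis
      by (simp add: s_eq[abs_def] s1_def algebra_simps)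
  qed
  have key: "4 * sqrt 3 * (C x)\<^sup>2 = 2 * sqrt 3 * ((D x)\<^sup>2 - (S x)\<^sup>2) - 3 * \<eta>" for x
  proof -
    have "3 * \<eta> = 2 * sqrt 3 * (1 - 2 * m)" using m4 by simp
    then show ?thesis unfolding C D(1) by (simp add: algebra_simps)
  qed
  have "elliptic_orbit \<eta> P s"
    unfolding elliptic_orbit_def
  proof (intro conjI allI exI[of _ s1])
    show "s (x + 1) = s x" for x
      by (simp add: s_eq D_def S_def \<psi>(2))
    show "(s has_vector_derivative s1 x) (at x)" for x
      by (rule deriv_s)
    fix x
    \<comment> \<open>Complex names for all quantities at \<open>x\<close> leave polynomial identities for \<open>algebra\<close>.\<close>
    define q d v c k t p e where
      defs: "q = complex_of_real (sqrt 3)" "d = complex_of_real (D x)"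
      "v = \<i> * complex_of_real (S x)" "c = complex_of_real (C x)" "k = complex_of_real \<kappa>"
      "t = s x" "p = complex_of_real P" "e = complex_of_real \<eta>"
    have q: "q\<^sup>2 = 3" by (simp add: defs flip: of_real_power)
    have kp: "k\<^sup>2 = 4 * q * p\<^sup>2"
      using arg_cong[OF P2, of complex_of_real] by (simp add: defs)
    have dv: "d\<^sup>2 - v\<^sup>2 = 1"
      using arg_cong[OF D(1)[of x], of complex_of_real] by (simp add: defs power_mult_distrib)
    have c: "4 * q * c\<^sup>2 = 2 * q * (d\<^sup>2 + v\<^sup>2) - 3 * e"
      using arg_cong[OF key[of x], of complex_of_real] by (simp add: defs power_mult_distrib)
    have t: "t\<^sup>2 = q * (d + v)\<^sup>2" by (simp add: defs s_sq)
    have "((\<lambda>x. \<i> * k * (of_real (C x) * s x)) has_vector_derivative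
        \<i> * k * (of_real (C x) * s1 x + of_real (- \<kappa> * S x * D x) * s x)) (at x)"
      by (intro has_vector_derivative_mult_right has_vector_derivative_mult
        has_vector_derivative_of_real C' deriv_s)
    moreover have "(\<lambda>x. \<i> * k * (of_real (C x) * s x)) = s1"
      by (simp add: fun_eq_iff s1_def defs)
    moreover have "\<i> * k * (of_real (C x) * s1 x + of_real (- \<kappa> * S x * D x) * s x)
        = - k\<^sup>2 * (c\<^sup>2 + d * v) * t"
      by (simp add: s1_def defs power2_eq_square algebra_simps)
    moreover have "- k\<^sup>2 * (c\<^sup>2 + d * v) * t = p\<^sup>2 * (3 * e * t - 2 * t ^ 3)"
    proof -
      have "4 * q * (c\<^sup>2 + d * v) = 2 * t\<^sup>2 - 3 * e"
        using c t by algebra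
      then show ?thesis using kp by algebra
    qed
    ultimately show "(s1 has_vector_derivative (of_real P)\<^sup>2 * (3 * of_real \<eta> * s x - 2 * s x ^ 3)) (at x)"
      by (simp add: defs)
    have "(s1 x)\<^sup>2 = - k\<^sup>2 * c\<^sup>2 * t\<^sup>2"
      by (simp add: s1_def defs power_mult_distrib)
    also have "\<dots> = p\<^sup>2 * (3 * e * t\<^sup>2 - t ^ 4 - 3)"
    proof -
      have "4 * q * c\<^sup>2 * t\<^sup>2 = 2 * q * (d\<^sup>2 + v\<^sup>2) * t\<^sup>2 - 3 * e * t\<^sup>2"
        using c by algebra
      moreover have "2 * q * (d\<^sup>2 + v\<^sup>2) * t\<^sup>2 = t ^ 4 + 3"
        using t q dv by algebra
      ultimately show ?thesis using kp by algebra
    qed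
    finally show "(s1 x)\<^sup>2 = (of_real P)\<^sup>2 * (3 * of_real \<eta> * (s x)\<^sup>2 - s x ^ 4 - 3)"
      by (simp add: defs)
  qed
  then show ?thesis by (simp add: P_def s_def)
qed

text \<open>
  The function \<open>csqrt (1 - m * (sin z)\<^sup>2)\<close> is holomorphic near the real line because its radicand is
  positive on it. This makes the differential equation of \<open>\<psi>\<close> analytic.
\<close>

lemma amplitude_analytic:
  assumes m: "0 \<le> m" "m < 1" and \<kappa>: "\<kappa> \<noteq> 0"
    and \<psi>: "\<And>x. (\<psi> has_real_derivative \<kappa> * sqrt (1 - m * (sin (\<psi> x))\<^sup>2)) (at x)"
  obtains H E where "H analytic_on {of_real x0}" "E analytic_on {of_real x0}"
    "\<forall>\<^sub>F x in nhds x0. of_real (\<psi> x) = H (of_real x) \<and>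
       of_real (sqrt (1 - m * (sin (\<psi> x))\<^sup>2)) = E (of_real x)"
proof -
  define gc where "gc z = csqrt (1 - of_real m * (sin z)\<^sup>2)" for z
  have real: "1 - of_real m * (sin (complex_of_real \<alpha>))\<^sup>2 = of_real (1 - m * (sin \<alpha>)\<^sup>2)" for \<alpha>
    by (simp add: sin_of_real)
  have gc_real: "gc (of_real \<alpha>) = of_real (sqrt (1 - m * (sin \<alpha>)\<^sup>2))" for \<alpha>
  proof -
    have "csqrt (of_real (1 - m * (sin \<alpha>)\<^sup>2)) = of_real (sqrt (1 - m * (sin \<alpha>)\<^sup>2))"
      using delta_pos[OF m, of \<alpha>] by (subst csqrt_of_real_nonneg) auto
    then show ?thesis
      unfolding gc_def real .
  qed
  have gc: "gc analytic_on {of_real \<alpha>}" for \<alpha>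
  proof -
    have "1 - of_real m * (sin (complex_of_real \<alpha>))\<^sup>2 \<notin> \<real>\<^sub>\<le>\<^sub>0"
      using delta_pos[OF m, of \<alpha>] by (simp only: real nonpos_Reals_of_real_iff not_le)
    then show ?thesis
      unfolding gc_def by (intro analytic_intros) auto
  qed
  have "\<exists>H. H analytic_on {of_real x0} \<and> (\<forall>\<^sub>F x in nhds x0. complex_of_real (\<psi> x) = H (of_real x))"
  proof (rule autonomous_ode_analytic)
    show "(\<lambda>z. of_real \<kappa> * gc z) analytic_on {complex_of_real (\<psi> x0)}"
      using gc by (intro analytic_intros) auto
    show "of_real \<kappa> * gc (complex_of_real (\<psi> x0)) \<noteq> 0"
      using \<kappa> delta_pos[OF m, of "\<psi> x0"] by (simp add: gc_real)
    show "((\<lambda>x. complex_of_real (\<psi> x)) has_vector_derivative of_real \<kappa> * gc (of_real (\<psi> x))) (at x)" for x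
      using has_vector_derivative_of_real[OF \<psi>] by (simp add: gc_real)
  qed
  then obtain H where H: "H analytic_on {of_real x0}"
    "\<forall>\<^sub>F x in nhds x0. complex_of_real (\<psi> x) = H (of_real x)"
    by blast
  have "H (of_real x0) = of_real (\<psi> x0)"
    using eventually_nhds_x_imp_x[OF H(2)] by simp
  then have "(\<lambda>z. gc (H z)) analytic_on {of_real x0}"
    using analytic_on_compose_gen[OF H(1), of gc "{of_real (\<psi> x0)}"] gc by (simp add: o_def)
  moreover have "\<forall>\<^sub>F x in nhds x0. of_real (\<psi> x) = H (of_real x) \<and>
      of_real (sqrt (1 - m * (sin (\<psi> x))\<^sup>2)) = gc (H (of_real x))"
    using H(2) by eventually_elim (metis gc_real)
  ultimately show ?thesis
    using that[OF H(1)] by blast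
qed

lemma real_analytic_orbit_equilibrium:
  assumes "0 \<le> m" "m < 1" "\<kappa> \<noteq> 0"
    and "\<And>x. (\<psi> has_real_derivative \<kappa> * sqrt (1 - m * (sin (\<psi> x))\<^sup>2)) (at x)"
  shows "real_analytic (orbit_equilibrium \<eta> P (pendulum_root m \<psi>))"
proof (rule real_analyticI)
  fix x0
  obtain H E where H: "H analytic_on {of_real x0}" and E: "E analytic_on {of_real x0}"
    and eq: "\<forall>\<^sub>F x in nhds x0. of_real (\<psi> x) = H (of_real x) \<and>
       of_real (sqrt (1 - m * (sin (\<psi> x))\<^sup>2)) = E (of_real x)"
    by (rule amplitude_analytic[OF assms])
  define U where "U z = 6 * (of_real P)\<^sup>2 *
    ((of_real (sqrt (sqrt 3)) * (E z + \<i> * (of_real (sqrt m) * sin (H z))))\<^sup>2 - of_real \<eta>)" for z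
  have "U analytic_on {of_real x0}"
    unfolding U_def using H E by (intro analytic_intros) auto
  moreover have "\<forall>\<^sub>F x in nhds x0. orbit_equilibrium \<eta> P (pendulum_root m \<psi>) x = U (of_real x)"
    using eq
  proof eventually_elim
    case (elim x)
    then have "H (of_real x) = of_real (\<psi> x)"
      "E (of_real x) = of_real (sqrt (1 - m * (sin (\<psi> x))\<^sup>2))"
      by simp_all
    then show ?case
      unfolding orbit_equilibrium_def U_def pendulum_root_def Complex_eq
      by (simp add: sin_of_real)
  qed
  ultimately show "\<exists>H. H analytic_on {of_real x0} \<and>
      (\<forall>\<^sub>F x in nhds x0. orbit_equilibrium \<eta> P (pendulum_root m \<psi>) x = H (of_real x))"
    by blast
qed

text \<open>
  The two signs of \<open>\<eta>\<close> belong to pendulums that turn back at the angles \<open>\<plusminus> pi / 6\<close> and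
  \<open>\<plusminus> 5 * pi / 6\<close>. The real part of \<open>s\<^sup>2\<close>, that is \<open>sqrt 3\<close> times the cosine of the angle, is
  smallest at these turning points; its minimum distinguishes the two orbits.
\<close>

lemma pendulum_orbit:
  assumes \<eta>: "\<eta> = 1 \<or> \<eta> = (- 1 :: real)"
  obtains P s where "P > 0" "elliptic_orbit \<eta> P s"
    "real_analytic (orbit_equilibrium \<eta> P s)"
    "(s 0)\<^sup>2 = of_real (sqrt 3)"
    "\<And>x. Re ((s x)\<^sup>2) \<ge> 3 * \<eta> / 2" "\<exists>x. Re ((s x)\<^sup>2) = 3 * \<eta> / 2"
proof -
  define m where "m = (2 - \<eta> * sqrt 3) / 4"
  have "sqrt 3 < 2" by (intro real_less_lsqrt) auto
  moreover have "- sqrt 3 < 2" using real_sqrt_ge_zero[of 3] by linarith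
  ultimately have m: "0 < m" "m < 1" using \<eta> by (auto simp: m_def)
  have m4: "sqrt 3 * (1 - 2 * m) = 3 * \<eta> / 2"
  proof -
    have "1 - 2 * m = \<eta> * sqrt 3 / 2" by (simp add: m_def field_simps)
    then show ?thesis unfolding \<open>1 - 2 * m = _\<close> by simp
  qed
  define g where "g \<alpha> = sqrt (1 - m * (sin \<alpha>)\<^sup>2)" for \<alpha>
  have g_pos: "g \<alpha> > 0" for \<alpha>
    using delta_pos m by (simp add: g_def)
  have "continuous_on UNIV g" unfolding g_def by (intro continuous_intros)
  then obtain \<kappa> \<psi> where \<kappa>: "\<kappa> > 0" and \<psi>: "\<And>x. (\<psi> has_real_derivative \<kappa> * g (\<psi> x)) (at x)"
    "\<And>x. \<psi> (x + 1) = \<psi> x + 2 * pi" "\<psi> 0 = 0" "surj \<psi>"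
    using rotation_exists[of g "2 * pi"] g_pos by (auto simp: g_def)
  define P s where "P = \<kappa> / (2 * sqrt (sqrt 3))" and "s = pendulum_root m \<psi>"
  have Re_s: "Re ((s x)\<^sup>2) = sqrt 3 * (1 - 2 * m * (sin (\<psi> x))\<^sup>2)" for x
    unfolding s_def using m by (intro Re_pendulum_root_square) auto
  have "P > 0" using \<kappa> by (simp add: P_def)
  moreover have "elliptic_orbit \<eta> P s"
    unfolding P_def s_def
    by (rule elliptic_orbit_pendulum_root[OF m m4 \<psi>(1)[unfolded g_def] \<psi>(2)])
  moreover have "real_analytic (orbit_equilibrium \<eta> P s)"
    unfolding s_def
    by (rule real_analytic_orbit_equilibrium[OF _ m(2) _ \<psi>(1)[unfolded g_def]]) (use m \<kappa> in auto)
  moreover have "(s 0)\<^sup>2 = of_real (sqrt 3)"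
    unfolding s_def pendulum_root_square by (simp add: \<psi>(3))
  moreover have "Re ((s x)\<^sup>2) \<ge> 3 * \<eta> / 2" for x
    using parameter_sin_le[of m "\<psi> x"] m unfolding Re_s m4[symmetric] by simp
  moreover have "\<exists>x. Re ((s x)\<^sup>2) = 3 * \<eta> / 2"
  proof -
    obtain x where "\<psi> x = pi / 2" using \<psi>(4) by (metis surjD)
    then have "sin (\<psi> x) = 1" by (simp only: sin_pi_half)
    then have "Re ((s x)\<^sup>2) = 3 * \<eta> / 2"
      unfolding Re_s m4[symmetric] by simp
    then show ?thesis by blast
  qed
  ultimately show ?thesis using that by blast
qed

text \<open>
  The roots of the quadratic equation for \<open>\<gamma>\<close> are \<open>(6 \<eta> \<plusminus> 3 \<i>) / 5\<close>, with eigenvalues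
  \<open>P\<^sup>2 (\<plusminus> 6 + 3 \<eta> \<i>)\<close>. The eigenfunction is nonzero because \<open>s 0\<close> has a real square.
\<close>

lemma orbit_eigenvalues:
  assumes \<eta>: "\<eta> = 1 \<or> \<eta> = (- 1 :: real)" and P: "P > 0" and orbit: "elliptic_orbit \<eta> P s"
    and s0: "(s 0)\<^sup>2 = of_real (sqrt 3)"
  defines "u \<equiv> orbit_equilibrium \<eta> P s"
  shows "\<exists>\<mu>. linearization_eigenvalue u \<mu> \<and> Re \<mu> > 0"
    and "\<exists>\<mu>. linearization_eigenvalue u \<mu> \<and> Re \<mu> < 0"
proof -
  have \<eta>2: "\<eta>\<^sup>2 = 1" using \<eta> by auto
  have eig: "linearization_eigenvalue u (\<i> * ((of_real P)\<^sup>2 * (15 * of_real \<eta> - 10 * \<gamma>)))"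
    if "\<gamma> = Complex (6 * \<eta> / 5) (3 * \<sigma> / 5)" "\<sigma>\<^sup>2 = 1" for \<gamma> \<sigma>
    unfolding u_def
  proof (rule eigenvalue_orbit[OF orbit \<eta>2])
    show "5 * \<gamma>\<^sup>2 - 12 * of_real \<eta> * \<gamma> + 9 = 0"
      unfolding that(1) using that(2) \<eta>2 by (simp add: complex_eq_iff power2_eq_square algebra_simps)
    show "s 0 \<noteq> 0" using s0 by auto
    have "Im \<gamma> \<noteq> 0" using that by auto
    then show "(s 0)\<^sup>2 \<noteq> \<gamma>" unfolding s0 by auto
  qed
  have re: "Re (\<i> * ((of_real P)\<^sup>2 * (15 * of_real \<eta> - 10 * Complex (6 * \<eta> / 5) (3 * \<sigma> / 5))))
      = 6 * P\<^sup>2 * \<sigma>" for \<sigma>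
    by (simp flip: of_real_power)
  show "\<exists>\<mu>. linearization_eigenvalue u \<mu> \<and> Re \<mu> > 0"
    using eig[OF refl, of 1] re[of 1] P by (metis mult_pos_pos zero_less_numeral zero_less_power
        mult.right_neutral power_one)
  show "\<exists>\<mu>. linearization_eigenvalue u \<mu> \<and> Re \<mu> < 0"
  proof (intro exI conjI)
    show "linearization_eigenvalue u (\<i> * ((of_real P)\<^sup>2 *
        (15 * of_real \<eta> - 10 * Complex (6 * \<eta> / 5) (3 * (- 1) / 5))))"
      by (rule eig[OF refl]) simp
    show "Re (\<i> * ((of_real P)\<^sup>2 * (15 * of_real \<eta> - 10 * Complex (6 * \<eta> / 5) (3 * (- 1) / 5)))) < 0"
      unfolding re using P by simp
  qed
qed

theorem theorem1p7:
  shows "\<exists>u1i u1ii :: real \<Rightarrow> complex.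
    u1i \<noteq> u1ii \<and>
    (\<forall>u1 \<in> {u1i, u1ii}.
       real_analytic u1 \<and> equilibrium u1 \<and> spectrally_unstable u1 \<and>
       (\<forall>n::nat. n \<ge> 1 \<longrightarrow>
          equilibrium (rescale n u1) \<and> spectrally_unstable (rescale n u1) \<and>
          equilibrium (\<lambda>x. cnj (rescale n u1 x)) \<and>
          spectrally_unstable (\<lambda>x. cnj (rescale n u1 x))) \<and>
       infinite {rescale n u1 | n. n \<ge> 1} \<and>
       infinite {(\<lambda>x. cnj (rescale n u1 x)) | n. n \<ge> 1})"
proof -
  obtain P s where 1: "P > 0" "elliptic_orbit 1 P s" "real_analytic (orbit_equilibrium 1 P s)"
    "(s 0)\<^sup>2 = of_real (sqrt 3)" "\<And>x. Re ((s x)\<^sup>2) \<ge> 3 * 1 / 2"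
    using pendulum_orbit[OF disjI1[OF refl]] by blast
  obtain Q t where 2: "Q > 0" "elliptic_orbit (- 1) Q t" "real_analytic (orbit_equilibrium (- 1) Q t)"
    "(t 0)\<^sup>2 = of_real (sqrt 3)" "\<exists>x. Re ((t x)\<^sup>2) = 3 * (- 1) / 2"
    by (rule pendulum_orbit[OF disjI2[OF refl]])
  have all: "real_analytic u \<and> equilibrium u \<and> spectrally_unstable u \<and>
       (\<forall>n::nat. n \<ge> 1 \<longrightarrow>
          equilibrium (rescale n u) \<and> spectrally_unstable (rescale n u) \<and>
          equilibrium (\<lambda>x. cnj (rescale n u x)) \<and>
          spectrally_unstable (\<lambda>x. cnj (rescale n u x))) \<and>
       infinite {rescale n u | n. n \<ge> 1} \<and>
       infinite {(\<lambda>x. cnj (rescale n u x)) | n. n \<ge> 1}"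
    if \<eta>: "\<eta> = 1 \<or> \<eta> = -1" and R: "R > 0" and o: "elliptic_orbit \<eta> R r"
      and an: "real_analytic (orbit_equilibrium \<eta> R r)"
      and r0: "(r 0)\<^sup>2 = of_real (sqrt 3)" and u: "u = orbit_equilibrium \<eta> R r"
    for \<eta> R r u
  proof -
    obtain \<mu> \<nu> where \<mu>: "linearization_eigenvalue u \<mu>" "Re \<mu> > 0"
      and \<nu>: "linearization_eigenvalue u \<nu>" "Re \<nu> < 0"
      using orbit_eigenvalues[OF \<eta> R o r0] u by blast
    have eq: "equilibrium u"
      using equilibrium_orbit[OF o] \<eta> u by auto
    have "sqrt 3 > 1" by simp
    then have "sqrt 3 - \<eta> \<noteq> 0"
      using \<eta> by linarith
    then have "of_real (sqrt 3 - \<eta>) \<noteq> (0::complex)"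
      unfolding of_real_eq_0_iff .
    then have "u 0 \<noteq> 0"
      using R by (simp add: u orbit_equilibrium_def r0)
    then show ?thesis
      using infinite_rescale[of u] eq equilibrium_rescale[OF eq]
        equilibrium_cnj[OF equilibrium_rescale[OF eq]]
        spectrally_unstable_rescale[OF \<mu>] spectrally_unstable_cnj_rescale[OF \<nu>]
        \<mu> an u unfolding spectrally_unstable_def by blast
  qed
  have distinct: "orbit_equilibrium 1 P s \<noteq> orbit_equilibrium (- 1) Q t"
  proof
    assume eq: "orbit_equilibrium 1 P s = orbit_equilibrium (- 1) Q t"
    obtain x where x: "Re ((t x)\<^sup>2) = 3 * (- 1) / 2" using 2 by blast
    have re: "Re (orbit_equilibrium \<eta> R r x) = 6 * R\<^sup>2 * (Re ((r x)\<^sup>2) - \<eta>)" for \<eta> R r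
      by (simp add: orbit_equilibrium_def flip: of_real_power)
    have "Re (orbit_equilibrium 1 P s x) > 0"
      unfolding re using 1(1) 1(5)[of x] by (intro mult_pos_pos) auto
    moreover have "Re (orbit_equilibrium (- 1) Q t x) < 0"
      unfolding re x using 2(1) by simp
    ultimately show False using eq by simp
  qed
  show ?thesis
    by (rule exI, rule exI, rule conjI[OF distinct], intro ballI, elim insertE emptyE)
      (rule all[OF _ 1(1-4)], simp, assumption, rule all[OF _ 2(1-4)], simp, assumption)
qed

end
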